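(* Let $\mathbb{E}$ be a (finite-dimensional) Euclidean space and $f\in\Gamma_0(\mathbb{E})$. Define $p_f:\mathbb{E}\times\mathbb{R}\to\mathbb{R}\cup\{+\infty\}$ by $p_f(x,\lambda)=e_\lambda f(x)$ if $\lambda>0$, $p_f(x,0)=f(x)$, and $p_f(x,\lambda)=+\infty$ if $\lambda<0$. Then $p_f\in\Gamma_0(\mathbb{E}\times\mathbb{R})$ and (a) $p_f^*(y,\mu)=f^*(y)+\delta_{\mathrm{epi}\,\frac12\|\cdot\|^2}(y,-\mu)$ for all $(y,\mu)\in\mathbb{E}\times\mathbb{R}$, and $p_f^*\in\Gamma_0(\mathbb{E}\times\mathbb{R})$; (b) for all $(x,\lambda)\in\mathrm{dom}\,p_f$, $$\partial p_f(x,\lambda)=\begin{cases}\left\{\left(\frac1\lambda[x-P_\lambda f(x)],\ -\frac12\left\|\frac1\lambda[x-P_\lambda f(x)]\right\|^2\right)\right\} & \text{if }\lambda>0,\\ \{(v,-\beta)\mid v\in\partial f(x),\ \frac12\|v\|^2\le\beta\} & \text{if }\lambda=0.\end{cases}$$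
   Context: $\Gamma_0(\mathbb{E})$ denotes the closed proper convex functions $\mathbb{E}\to\mathbb{R}\cup\{+\infty\}$. For $\lambda>0$, $e_\lambda f(x)=\min_{u}\{f(u)+\frac1{2\lambda}\|x-u\|^2\}$ is the Moreau envelope and $P_\lambda f(x)$ is the unique minimizer (proximal map). $f^*$ is the Fenchel conjugate, $\delta_C$ the indicator function of $C$, $\mathrm{epi}$ the epigraph, $\partial$ the convex subdifferential. *)

theory Defs
  imports "HOL-Analysis.Analysis"
begin

definition edom :: "('a \<Rightarrow> ereal) \<Rightarrow> 'a set" where
  "edom f = {x. f x < \<infinity>}"

text \<open>Unlike the library's \<open>epigraph\<close>, this is for extended-real-valued functions;
  the second component of its points is still a real number.\<close>

definition epi :: "('a \<Rightarrow> ereal) \<Rightarrow> ('a \<times> real) set" where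
  "epi f = {(x, \<alpha>). f x \<le> ereal \<alpha>}"

definition proper :: "('a \<Rightarrow> ereal) \<Rightarrow> bool" where
  "proper f \<longleftrightarrow> edom f \<noteq> {} \<and> (\<forall>x. f x \<noteq> -\<infinity>)"

text \<open>Closed proper convex functions. Properness excludes the value \<open>-\<infinity>\<close>, so that members
  are functions into the reals extended by \<open>+\<infinity>\<close> only. A function is closed (convex) if its
  epigraph is.\<close>

definition Gamma0 :: "('a::real_normed_vector \<Rightarrow> ereal) set" where
  "Gamma0 = {f. closed (epi f) \<and> proper f \<and> convex (epi f)}"

definition conjugate :: "('a::real_inner \<Rightarrow> ereal) \<Rightarrow> 'a \<Rightarrow> ereal" where
  "conjugate f y = (SUP x. ereal (x \<bullet> y) - f x)"

definition subdifferential :: "('a::real_inner \<Rightarrow> ereal) \<Rightarrow> 'a \<Rightarrow> 'a set" where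
  "subdifferential f x = {v. \<forall>y. f x + ereal (v \<bullet> (y - x)) \<le> f y}"

definition ind :: "'a set \<Rightarrow> 'a \<Rightarrow> ereal" where
  "ind C x = (if x \<in> C then 0 else \<infinity>)"

definition prox_objective :: "real \<Rightarrow> ('a::real_normed_vector \<Rightarrow> ereal) \<Rightarrow> 'a \<Rightarrow> 'a \<Rightarrow> ereal" where
  "prox_objective t f x u = f u + ereal (1 / (2 * t) * (norm (x - u))\<^sup>2)"

text \<open>A minimum and a unique minimizer, as opposed to an infimum and a chosen minimizer. Both are
  meaningful for \<open>f \<in> Gamma0\<close> on a finite-dimensional space and \<open>t > 0\<close>.\<close>

definition moreau_envelope :: "real \<Rightarrow> ('a::real_normed_vector \<Rightarrow> ereal) \<Rightarrow> 'a \<Rightarrow> ereal" where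
  "moreau_envelope t f x = (LEAST r. r \<in> range (prox_objective t f x))"

definition prox :: "real \<Rightarrow> ('a::real_normed_vector \<Rightarrow> ereal) \<Rightarrow> 'a \<Rightarrow> 'a" where
  "prox t f x = (THE u. is_arg_min (prox_objective t f x) (\<lambda>_. True) u)"

definition p_fun :: "('a::real_normed_vector \<Rightarrow> ereal) \<Rightarrow> 'a \<times> real \<Rightarrow> ereal" where
  "p_fun f = (\<lambda>(x, t). if t > 0 then moreau_envelope t f x else if t = 0 then f x else \<infinity>)"

end

theory Submission
  imports Defs
begin

text \<open>Everything is read off one geometric description: the epigraph of \<open>p_fun f\<close> is the Minkowski
  sum of the epigraph of \<open>f\<close>, placed in the hyperplane \<open>t = 0\<close>, and the convex cone of all
  \<open>(z, t, r)\<close> with \<open>t, r \<ge> 0\<close> and \<open>(norm z)\<^sup>2 \<le> 2 * t * r\<close> (\<open>epi_p_fun\<close>). At \<open>t = 0\<close> the cone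
  contributes only upward translations, which is why \<open>f\<close> itself is the right boundary value.

  Convexity of the sum is automatic. The sum is closed because \<open>f\<close> has an affine minorant, which
  bounds the summands in terms of the sum (\<open>closed_epi_sum\<close>). Closedness also yields the existence of
  proximal points: the infimum of the proximal objective belongs to a closed slice of the sum.

  The conjugate of a function is the support function of its epigraph, so the conjugate of \<open>p_fun f\<close>
  is the sum of the conjugate of \<open>f\<close> and the support function of the cone, which by Young's
  inequality is the indicator of \<open>1/2 * (norm y)\<^sup>2 \<le> - \<mu>\<close> (\<open>conjugate_p_fun\<close>).

  Subgradients are the points of equality in the Fenchel-Young inequality. At \<open>t = 0\<close> this gives the
  stated set at once. For \<open>t > 0\<close> it splits into equality in the Fenchel-Young inequality of \<open>f\<close> at
  the proximal point, which is the optimality condition \<open>prox_optimality\<close>, and equality in Young's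
  inequality, which leaves one vector only.\<close>

section \<open>Epigraphs, conjugates and subgradients\<close>

lemma Gamma0_finite:
  assumes "f \<in> Gamma0"
  shows "f x \<noteq> -\<infinity>"
  using assms by (auto simp: Gamma0_def proper_def)

lemma Gamma0_epi_nonempty:
  assumes "f \<in> Gamma0"
  obtains x a where "f x = ereal a" "(x, a) \<in> epi f"
proof -
  obtain x where "f x < \<infinity>" "f x \<noteq> -\<infinity>"
    using assms by (auto simp: Gamma0_def proper_def edom_def)
  then show ?thesis
    using that by (cases "f x") (auto simp: epi_def)
qed

lemma ereal_eqI_le_real:
  fixes x y :: ereal
  assumes "\<And>c::real. x \<le> ereal c \<longleftrightarrow> y \<le> ereal c"
  shows "x = y"
  by (meson antisym assms ereal_le_real)

text \<open>The conjugate is the support function of the epigraph in the direction \<open>(y, -1)\<close>. This needs no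
  properness: where \<open>f\<close> is \<open>-\<infinity>\<close>, the epigraph contains a whole vertical line and both sides
  fail.\<close>

lemma conjugate_le_iff:
  "conjugate f y \<le> ereal c \<longleftrightarrow> (\<forall>(x, a) \<in> epi f. x \<bullet> y - a \<le> c)"
proof -
  have "ereal (x \<bullet> y) - f x \<le> ereal c \<longleftrightarrow> (\<forall>a. f x \<le> ereal a \<longrightarrow> x \<bullet> y - a \<le> c)" for x
  proof (cases "f x")
    case MInf
    then show ?thesis
      by (auto simp: not_le intro!: exI[of _ "x \<bullet> y - c - 1"])
  qed (auto simp: algebra_simps)
  then show ?thesis
    by (auto simp: conjugate_def SUP_le_iff epi_def)
qed

lemma subdifferential_iff_conjugate_le:
  assumes "f x = ereal b"
  shows "v \<in> subdifferential f x \<longleftrightarrow> conjugate f v \<le> ereal (x \<bullet> v - b)"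
proof -
  have "v \<in> subdifferential f x \<longleftrightarrow> (\<forall>y. ereal (b + v \<bullet> (y - x)) \<le> f y)"
    using assms by (simp add: subdifferential_def)
  also have "\<dots> \<longleftrightarrow> (\<forall>(y, a) \<in> epi f. b + v \<bullet> (y - x) \<le> a)"
    unfolding epi_def
    by (auto intro: ereal_le_real order_trans simp flip: ereal_less_eq(3))
  also have "\<dots> \<longleftrightarrow> conjugate f v \<le> ereal (x \<bullet> v - b)"
    by (auto simp: conjugate_le_iff inner_diff_right inner_commute algebra_simps)
  finally show ?thesis .
qed

text \<open>A point strictly below the graph of \<open>f\<close> is strictly separated from the epigraph by a
  hyperplane, which cannot be vertical because the epigraph has a point on the same vertical
  line.\<close>

lemma Gamma0_affine_minorant:
  fixes f :: "'a::euclidean_space \<Rightarrow> ereal"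
  assumes "f \<in> Gamma0"
  obtains v c where "\<And>u a. (u, a) \<in> epi f \<Longrightarrow> v \<bullet> u - c \<le> a"
proof -
  obtain x b where xb: "f x = ereal b" "(x, b) \<in> epi f"
    using Gamma0_epi_nonempty[OF assms] .
  have "closed (epi f)" "convex (epi f)" "(x, b - 1) \<notin> epi f"
    using assms xb by (auto simp: Gamma0_def epi_def)
  then obtain n k where "n \<bullet> (x, b - 1) < k" and n: "\<And>p. p \<in> epi f \<Longrightarrow> n \<bullet> p > k"
    using separating_hyperplane_closed_point by metis
  moreover obtain w s where ws: "n = (w, s)" by (cases n)
  ultimately have "w \<bullet> x + s * (b - 1) < w \<bullet> x + s * b"
    using n[OF xb(2)] by (auto simp: inner_Pair)
  then have s: "s > 0" by (simp add: algebra_simps)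
  have "(- (1 / s) *\<^sub>R w) \<bullet> u - (- k / s) \<le> a" if "(u, a) \<in> epi f" for u a
    using n[OF that] s by (simp add: ws inner_Pair field_simps)
  then show ?thesis using that by blast
qed

lemma conjugate_not_MInf:
  assumes "f \<in> Gamma0"
  shows "conjugate f y \<noteq> -\<infinity>"
proof
  assume "conjugate f y = -\<infinity>"
  then have "conjugate f y \<le> ereal c" for c by simp
  moreover obtain x a where xa: "(x, a) \<in> epi f"
    using Gamma0_epi_nonempty[OF assms] by blast
  ultimately have "x \<bullet> y - a \<le> x \<bullet> y - a - 1"
    unfolding conjugate_le_iff by blast
  then show False by simp
qed

lemma conjugate_Gamma0:
  fixes f :: "'a::euclidean_space \<Rightarrow> ereal"
  assumes "f \<in> Gamma0"
  shows "conjugate f \<in> Gamma0"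
proof -
  have "epi (conjugate f) = (\<Inter>(x, a) \<in> epi f. {p. (x, -1) \<bullet> p \<le> a})"
    by (fastforce simp: epi_def[of "conjugate f"] conjugate_le_iff inner_Pair)
  moreover have "closed (\<Inter>(x, a) \<in> epi f. {p. (x, -1::real) \<bullet> p \<le> a})"
    by (intro closed_INT) (auto intro: closed_halfspace_le)
  moreover have "convex (\<Inter>(x, a) \<in> epi f. {p. (x, -1::real) \<bullet> p \<le> a})"
    by (intro convex_INT) (auto intro: convex_halfspace_le)
  moreover have "proper (conjugate f)"
  proof -
    obtain v c where "\<And>u a. (u, a) \<in> epi f \<Longrightarrow> v \<bullet> u - c \<le> a"
      using Gamma0_affine_minorant[OF assms] by blast
    then have "conjugate f v \<le> ereal c"
      by (fastforce simp: conjugate_le_iff inner_commute)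
    then have "v \<in> edom (conjugate f)"
      by (auto simp: edom_def intro: le_less_trans)
    then show ?thesis
      using conjugate_not_MInf[OF assms] by (auto simp: proper_def)
  qed
  ultimately show ?thesis by (simp add: Gamma0_def)
qed

section \<open>The cone of the perspective of half the squared norm\<close>

text \<open>The epigraph of \<open>(z, t) \<mapsto> (norm z)\<^sup>2 / (2 * t)\<close> for \<open>t > 0\<close>, closed up at \<open>t = 0\<close>
  by the half-line \<open>z = 0\<close>, \<open>r \<ge> 0\<close>.\<close>

definition perspective_cone :: "('a::real_inner \<times> real \<times> real) set" where
  "perspective_cone = {(z, t, r). 0 \<le> t \<and> 0 \<le> r \<and> (norm z)\<^sup>2 \<le> 2 * t * r}"

lemma closed_perspective_cone: "closed perspective_cone"
  unfolding perspective_cone_def split_def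
  by (intro closed_Collect_conj closed_Collect_le continuous_intros)

text \<open>The cone is invariant under sums: the cross term is controlled by
  \<open>z \<bullet> z' \<le> 2 * sqrt (t * r * t' * r') \<le> t * r' + t' * r\<close>.\<close>

lemma perspective_cone_add:
  assumes "(z, t, r) \<in> perspective_cone" "(z', t', r') \<in> perspective_cone"
  shows "(z + z', t + t', r + r') \<in> perspective_cone"
proof -
  have nn: "0 \<le> t" "0 \<le> r" "0 \<le> t'" "0 \<le> r'"
    and z: "(norm z)\<^sup>2 \<le> 2 * t * r" "(norm z')\<^sup>2 \<le> 2 * t' * r'"
    using assms by (auto simp: perspective_cone_def)
  have "(norm z * norm z')\<^sup>2 \<le> (2 * t * r) * (2 * t' * r')"
    unfolding power_mult_distrib using z nn by (intro mult_mono) auto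
  also have "\<dots> \<le> (t * r' + t' * r)\<^sup>2"
    using zero_le_power2[of "t * r' - t' * r"] by (simp add: power2_eq_square algebra_simps)
  finally have "norm z * norm z' \<le> t * r' + t' * r"
    by (rule power2_le_imp_le) (use nn in auto)
  then have "z \<bullet> z' \<le> t * r' + t' * r"
    using norm_cauchy_schwarz[of z z'] by linarith
  then have "(norm (z + z'))\<^sup>2 \<le> 2 * (t + t') * (r + r')"
    using z by (simp add: power2_norm_eq_inner inner_add_left inner_add_right inner_commute
        algebra_simps)
  then show ?thesis using nn by (simp add: perspective_cone_def)
qed

lemma convex_perspective_cone: "convex perspective_cone"
proof -
  have "(a *\<^sub>R z, a *\<^sub>R t, a *\<^sub>R r) \<in> perspective_cone"
    if "(z, t, r) \<in> perspective_cone" "0 \<le> a" for a t r and z :: 'a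
    using that mult_left_mono[of "(norm z)\<^sup>2" "2 * t * r" "a\<^sup>2"]
    by (auto simp: perspective_cone_def power_mult_distrib power2_eq_square algebra_simps)
  then show ?thesis
    unfolding convex_def by (auto intro!: perspective_cone_add)
qed

text \<open>Young's inequality: if \<open>1/2 * (norm y)\<^sup>2 \<le> - \<mu>\<close>, then \<open>(y, \<mu>, -1)\<close> belongs to the polar of the
  cone.\<close>

lemma perspective_cone_polar:
  assumes "(z, t, r) \<in> perspective_cone" "1/2 * (norm y)\<^sup>2 \<le> - \<mu>"
  shows "z \<bullet> y + t * \<mu> \<le> r"
proof -
  have tr: "0 \<le> t" "0 \<le> r" "(norm z)\<^sup>2 \<le> 2 * t * r"
    using assms by (auto simp: perspective_cone_def)
  have "(norm z * norm y)\<^sup>2 \<le> (2 * t * r) * (norm y)\<^sup>2"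
    unfolding power_mult_distrib using tr by (intro mult_right_mono) auto
  also have "\<dots> \<le> (r + t * (1/2 * (norm y)\<^sup>2))\<^sup>2"
    using zero_le_power2[of "r - t * (1/2 * (norm y)\<^sup>2)"]
    by (simp add: power2_eq_square algebra_simps)
  finally have "norm z * norm y \<le> r + t * (1/2 * (norm y)\<^sup>2)"
    by (rule power2_le_imp_le) (use tr in auto)
  moreover have "t * (1/2 * (norm y)\<^sup>2) \<le> t * (- \<mu>)"
    using assms tr by (intro mult_left_mono) auto
  ultimately show ?thesis
    using norm_cauchy_schwarz[of z y] by simp
qed

section \<open>The sum of the epigraph and the cone\<close>

text \<open>The Minkowski sum of the points \<open>((u, 0), a)\<close> with \<open>(u, a)\<close> in the epigraph of \<open>f\<close> and the
  points \<open>((z, t), r)\<close> of the cone. Writing \<open>x = u + z\<close> one recognises the points that lie above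
  \<open>f u + (norm (x - u))\<^sup>2 / (2 * t)\<close> for some \<open>u\<close>.\<close>

definition epi_sum :: "('a::real_inner \<Rightarrow> ereal) \<Rightarrow> (('a \<times> real) \<times> real) set" where
  "epi_sum f = (\<lambda>((u, a), (z, t, r)). ((u + z, t), a + r)) ` (epi f \<times> perspective_cone)"

lemma mem_epi_sum_iff:
  "((x, t), \<alpha>) \<in> epi_sum f \<longleftrightarrow>
    (\<exists>u r. (u, \<alpha> - r) \<in> epi f \<and> (x - u, t, r) \<in> perspective_cone)"
proof
  assume "((x, t), \<alpha>) \<in> epi_sum f"
  then obtain u a z r where "(u, a) \<in> epi f" "(z, t, r) \<in> perspective_cone" "x = u + z" "\<alpha> = a + r"
    by (auto simp: epi_sum_def)
  then show "\<exists>u r. (u, \<alpha> - r) \<in> epi f \<and> (x - u, t, r) \<in> perspective_cone"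
    by (intro exI[of _ u] exI[of _ r]) simp
next
  assume "\<exists>u r. (u, \<alpha> - r) \<in> epi f \<and> (x - u, t, r) \<in> perspective_cone"
  then obtain u r where "((u, \<alpha> - r), (x - u, t, r)) \<in> epi f \<times> perspective_cone" by blast
  then show "((x, t), \<alpha>) \<in> epi_sum f"
    unfolding epi_sum_def by (rule rev_image_eqI) simp
qed

lemma linear_epi_sum_map:
  "linear (\<lambda>((u::'a::real_vector, a::real), (z, t::real, r)). ((u + z, t), a + r))"
  by (rule linearI) (auto simp: algebra_simps)

lemma convex_epi_sum:
  assumes "f \<in> Gamma0"
  shows "convex (epi_sum f)"
  unfolding epi_sum_def using assms
  by (intro convex_linear_image linear_epi_sum_map convex_Times convex_perspective_cone)
    (simp add: Gamma0_def)

lemma closed_image_bounded_preimages: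
  fixes h :: "'a::heine_borel \<Rightarrow> 'b::metric_space"
  assumes "closed T" and cont: "continuous_on UNIV h"
    and bdd: "\<And>B. bounded B \<Longrightarrow> bounded (T \<inter> h -` B)"
  shows "closed (h ` T)"
  unfolding closed_sequential_limits
proof (intro allI impI, elim conjE)
  fix q l assume q: "\<forall>n. q n \<in> h ` T" and lim: "q \<longlonglongrightarrow> l"
  from q have "\<exists>p. \<forall>n. p n \<in> T \<and> q n = h (p n)"
    by (intro choice) blast
  then obtain p where p: "\<And>n. p n \<in> T" "\<And>n. q n = h (p n)" by blast
  have "bounded (range q)" using lim by (rule convergent_imp_bounded)
  then have "bounded (range p)"
    by (rule bounded_subset[OF bdd]) (use p in auto)
  then obtain k \<sigma> where "strict_mono \<sigma>" and k: "(p \<circ> \<sigma>) \<longlonglongrightarrow> k"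
    using bounded_imp_convergent_subsequence[of p] by auto
  with lim have "(q \<circ> \<sigma>) \<longlonglongrightarrow> l" by (intro LIMSEQ_subseq_LIMSEQ)
  moreover have "(\<lambda>n. h ((p \<circ> \<sigma>) n)) \<longlonglongrightarrow> h k"
    using cont by (intro isCont_tendsto_compose[OF _ k]) (simp add: continuous_on_eq_continuous_at)
  ultimately have "l = h k"
    by (simp add: o_def p(2) LIMSEQ_unique)
  moreover have "k \<in> T"
    by (rule closed_sequentially[OF \<open>closed T\<close> _ k]) (simp add: p)
  ultimately show "l \<in> h ` T" by blast
qed

text \<open>The quadratic growth along the cone beats the affine minorant of \<open>f\<close>, so that bounded
  sums have bounded summands.\<close>

lemma closed_epi_sum:
  fixes f :: "'a::euclidean_space \<Rightarrow> ereal"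
  assumes f: "f \<in> Gamma0"
  shows "closed (epi_sum f)"
  unfolding epi_sum_def
proof (rule closed_image_bounded_preimages)
  let ?h = "\<lambda>((u::'a, a::real), (z, t::real, r)). ((u + z, t), a + r)"
  show "closed (epi f \<times> (perspective_cone :: ('a \<times> real \<times> real) set))"
    using f by (simp add: Gamma0_def closed_Times closed_perspective_cone)
  show "continuous_on UNIV ?h"
    using linear_epi_sum_map by (rule linear_continuous_on[OF linear_conv_bounded_linear[THEN iffD1]])
  fix B :: "(('a \<times> real) \<times> real) set" assume "bounded B"
  then obtain M where M: "M > 0" "\<And>p. p \<in> B \<Longrightarrow> norm p \<le> M"
    by (auto simp: bounded_pos)
  obtain v c where v: "\<And>u a. (u, a) \<in> epi f \<Longrightarrow> v \<bullet> u - c \<le> a"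
    using Gamma0_affine_minorant[OF f] by blast
  define A where "A = M + norm v * M + \<bar>c\<bar>"
  define D where "D = 2 * M * (A + norm v) + 1"
  define R where "R = A + norm v * D"
  have A: "A \<ge> 0" unfolding A_def using M by simp
  have D: "D \<ge> 1" unfolding D_def using M A by simp
  have R: "R \<ge> 0" unfolding R_def using A D by simp
  have "norm p \<le> ((M + D) + (M + R)) + (D + (M + R))"
    if "p \<in> (epi f \<times> perspective_cone) \<inter> ?h -` B" for p
  proof -
    obtain u a z t r where p: "p = ((u, a), (z, t, r))" by (metis surj_pair)
    have K: "(u, a) \<in> epi f" "0 \<le> t" "0 \<le> r" "(norm z)\<^sup>2 \<le> 2 * t * r"
      and B: "((u + z, t), a + r) \<in> B"
      using that by (auto simp: p perspective_cone_def)
    have "norm (u + z) \<le> M" "\<bar>t\<bar> \<le> M" "\<bar>a + r\<bar> \<le> M"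
      using M(2)[OF B] norm_fst_le[of "(u + z, t)" "a + r"] norm_snd_le[of "a + r" "(u + z, t)"]
        norm_fst_le[of "u + z" t] norm_snd_le[of t "u + z"] by auto
    note bounds = this
    have u: "norm u \<le> M + norm z"
      using bounds(1) norm_triangle_ineq4[of "u + z" z] by simp
    have "- (v \<bullet> u) \<le> norm v * norm u"
      using norm_cauchy_schwarz[of "- v" u] by simp
    also have "\<dots> \<le> norm v * (M + norm z)"
      using u by (intro mult_left_mono) auto
    finally have r: "r \<le> A + norm v * norm z"
      using v[OF K(1)] bounds(3) by (simp add: A_def algebra_simps)
    have z: "norm z \<le> D"
    proof (cases "norm z \<le> 1")
      case True
      then show ?thesis using D by simp
    next
      case False
      have "(norm z)\<^sup>2 \<le> 2 * M * (A + norm v * norm z)"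
        using K r bounds(2) M by (intro order_trans[OF K(4)] mult_mono) auto
      also have "\<dots> \<le> 2 * M * (A * norm z + norm v * norm z)"
        using False M A mult_left_mono[of 1 "norm z" A] by (intro mult_left_mono) auto
      finally have "norm z * norm z \<le> norm z * (2 * M * (A + norm v))"
        by (simp add: power2_eq_square algebra_simps)
      then have "norm z \<le> 2 * M * (A + norm v)"
        using False by (subst (asm) mult_le_cancel_left_pos) auto
      then show ?thesis by (simp add: D_def)
    qed
    then have "r \<le> R"
      using r mult_left_mono[OF z norm_ge_zero[of v]] by (simp add: R_def)
    then have "norm (u, a) \<le> (M + D) + (M + R)" "norm (z, t, r) \<le> D + (M + R)"
      using u z bounds K norm_Pair_le[of u a] norm_Pair_le[of z "(t, r)"] norm_Pair_le[of t r]
      by auto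
    then show ?thesis
      unfolding p using norm_Pair_le[of "(u, a)" "(z, t, r)"] by linarith
  qed
  then show "bounded ((epi f \<times> perspective_cone) \<inter> ?h -` B)"
    unfolding bounded_iff by blast
qed

text \<open>The inequality between the support function of the sum and those of the summands.\<close>

lemma epi_sum_bound:
  assumes le: "conjugate f y \<le> ereal c" and y: "1/2 * (norm y)\<^sup>2 \<le> - \<mu>"
    and mem: "((x, t), \<alpha>) \<in> epi_sum f"
  shows "x \<bullet> y + t * \<mu> - \<alpha> \<le> c"
proof -
  obtain u r where "(u, \<alpha> - r) \<in> epi f" and K: "(x - u, t, r) \<in> perspective_cone"
    using mem by (auto simp: mem_epi_sum_iff)
  then have "u \<bullet> y - (\<alpha> - r) \<le> c"
    using le by (auto simp: conjugate_le_iff)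
  with perspective_cone_polar[OF K y] show ?thesis
    by (simp add: inner_diff_left)
qed

section \<open>Proximal points\<close>

lemma prox_objective_le_iff:
  assumes "t > 0"
  shows "(\<exists>u. prox_objective t f x u \<le> ereal \<alpha>) \<longleftrightarrow> ((x, t), \<alpha>) \<in> epi_sum f"
proof -
  have "prox_objective t f x u \<le> ereal \<alpha> \<longleftrightarrow>
      (\<exists>r. (u, \<alpha> - r) \<in> epi f \<and> (x - u, t, r) \<in> perspective_cone)" for u
  proof
    assume "prox_objective t f x u \<le> ereal \<alpha>"
    then have "f u \<le> ereal (\<alpha> - 1 / (2 * t) * (norm (x - u))\<^sup>2)"
      by (cases "f u") (auto simp: prox_objective_def algebra_simps)
    moreover have "(x - u, t, 1 / (2 * t) * (norm (x - u))\<^sup>2) \<in> perspective_cone"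
      using assms by (simp add: perspective_cone_def)
    ultimately show "\<exists>r. (u, \<alpha> - r) \<in> epi f \<and> (x - u, t, r) \<in> perspective_cone"
      by (auto simp: epi_def)
  next
    assume "\<exists>r. (u, \<alpha> - r) \<in> epi f \<and> (x - u, t, r) \<in> perspective_cone"
    then obtain r where r: "f u \<le> ereal (\<alpha> - r)" "(norm (x - u))\<^sup>2 \<le> 2 * t * r"
      by (auto simp: epi_def perspective_cone_def)
    have "1 / (2 * t) * (norm (x - u))\<^sup>2 \<le> r"
      using r(2) assms by (simp add: field_simps)
    with r(1) show "prox_objective t f x u \<le> ereal \<alpha>"
      by (cases "f u") (auto simp: prox_objective_def)
  qed
  then show ?thesis by (auto simp: mem_epi_sum_iff)
qed

text \<open>The upper bounds of values of the objective form a slice of the closed set \<open>epi_sum f\<close>. They are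
  bounded below, since an affine minorant of \<open>f\<close> extends to one of \<open>epi_sum f\<close>, so their infimum is
  one of them.\<close>

lemma prox_objective_attains_min:
  fixes f :: "'a::euclidean_space \<Rightarrow> ereal"
  assumes f: "f \<in> Gamma0" and t: "t > 0"
  obtains u b where "f u = ereal b" "\<And>w. prox_objective t f x u \<le> prox_objective t f x w"
proof -
  define L where "L = {\<alpha>. ((x, t), \<alpha>) \<in> epi_sum f}"
  have "closed (Pair (x, t) -` epi_sum f)"
    by (intro closed_vimage closed_epi_sum f continuous_intros)
  then have "closed L" by (simp add: L_def vimage_def)
  obtain x0 a where x0: "f x0 = ereal a"
    using Gamma0_epi_nonempty[OF f] by blast
  have "L \<noteq> {}"
    using prox_objective_le_iff[OF t, of f x "a + 1 / (2 * t) * (norm (x - x0))\<^sup>2"] x0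
    unfolding L_def by (auto simp: prox_objective_def intro!: exI[of _ x0])
  obtain v c where "\<And>u a. (u, a) \<in> epi f \<Longrightarrow> v \<bullet> u - c \<le> a"
    using Gamma0_affine_minorant[OF f] by blast
  then have "conjugate f v \<le> ereal c"
    by (fastforce simp: conjugate_le_iff inner_commute)
  then have "x \<bullet> v + t * (- (1/2 * (norm v)\<^sup>2)) - c \<le> \<alpha>" if "\<alpha> \<in> L" for \<alpha>
    using epi_sum_bound[of f v c "- (1/2 * (norm v)\<^sup>2)" x t \<alpha>] that by (simp add: L_def)
  then have bdd: "bdd_below L" by (rule bdd_belowI)
  have "Inf L \<in> L"
    by (rule closed_contains_Inf) fact+
  then obtain u where u: "prox_objective t f x u \<le> ereal (Inf L)"
    using prox_objective_le_iff[OF t] unfolding L_def by blast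
  moreover have "ereal (Inf L) \<le> prox_objective t f x w" for w
  proof (rule ereal_le_real)
    fix \<alpha> assume "prox_objective t f x w \<le> ereal \<alpha>"
    then have "\<alpha> \<in> L" unfolding L_def using prox_objective_le_iff[OF t] by blast
    then show "ereal (Inf L) \<le> ereal \<alpha>" using bdd by (simp add: cInf_lower)
  qed
  ultimately have "prox_objective t f x u \<le> prox_objective t f x w" for w
    using order_trans by blast
  moreover obtain b where "f u = ereal b"
    using u Gamma0_finite[OF f, of u] by (cases "f u") (auto simp: prox_objective_def)
  ultimately show ?thesis using that by blast
qed

text \<open>Fermat's rule: a minimizer \<open>u\<close> satisfies \<open>(x - u) / t \<in> \<partial>f(u)\<close>. The difference quotient along
  the segment from \<open>u\<close> to a point of the epigraph is nonnegative, and its quadratic part vanishes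
  in the limit.\<close>

lemma prox_optimality:
  fixes f :: "'a::real_inner \<Rightarrow> ereal"
  assumes f: "f \<in> Gamma0" and t: "t > 0" and b: "f u = ereal b"
    and min: "\<And>w. prox_objective t f x u \<le> prox_objective t f x w"
  shows "(1 / t) *\<^sub>R (x - u) \<in> subdifferential f u"
proof -
  have "w \<bullet> ((1 / t) *\<^sub>R (x - u)) - a \<le> u \<bullet> ((1 / t) *\<^sub>R (x - u)) - b" if wa: "(w, a) \<in> epi f" for w a
  proof -
    define d where "d = a - b - (x - u) \<bullet> (w - u) / t"
    define e where "e = (norm (w - u))\<^sup>2 / (2 * t)"
    have "0 \<le> d + s * e" if s: "0 < s" "s < 1" for s
    proof -
      have "(u, b) \<in> epi f" using b by (simp add: epi_def)
      then have "(1 - s) *\<^sub>R (u, b) + s *\<^sub>R (w, a) \<in> epi f"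
        using f wa s by (intro convexD) (auto simp: Gamma0_def)
      moreover have "(1 - s) *\<^sub>R u + s *\<^sub>R w = u + s *\<^sub>R (w - u)"
        by (simp add: algebra_simps)
      ultimately have "f (u + s *\<^sub>R (w - u)) \<le> ereal ((1 - s) * b + s * a)"
        by (simp add: epi_def)
      then have "prox_objective t f x u
          \<le> ereal ((1 - s) * b + s * a) + ereal (1 / (2 * t) * (norm (x - (u + s *\<^sub>R (w - u))))\<^sup>2)"
        using min[of "u + s *\<^sub>R (w - u)"] add_right_mono order_trans
        unfolding prox_objective_def by blast
      then have "b + (norm (x - u))\<^sup>2 / (2 * t)
          \<le> (1 - s) * b + s * a + (norm ((x - u) - s *\<^sub>R (w - u)))\<^sup>2 / (2 * t)"
        by (simp add: prox_objective_def b diff_diff_eq)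
      moreover have "(norm ((x - u) - s *\<^sub>R (w - u)))\<^sup>2
          = (norm (x - u))\<^sup>2 - 2 * s * ((x - u) \<bullet> (w - u)) + s\<^sup>2 * (norm (w - u))\<^sup>2"
        unfolding power2_norm_eq_inner
        by (simp add: inner_diff_left inner_diff_right inner_commute power2_eq_square algebra_simps)
      ultimately have "b + (norm (x - u))\<^sup>2 / (2 * t) \<le> (1 - s) * b + s * a
          + ((norm (x - u))\<^sup>2 - 2 * s * ((x - u) \<bullet> (w - u)) + s\<^sup>2 * (norm (w - u))\<^sup>2) / (2 * t)"
        by simp
      also have "\<dots> = b + (norm (x - u))\<^sup>2 / (2 * t) + s * (d + s * e)"
      proof -
        have "b + P / (2 * t) + s * (a - b - q / t + s * (N / (2 * t)))
            = (1 - s) * b + s * a + (P - 2 * s * q + s\<^sup>2 * N) / (2 * t)" for P q N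
          using t by (simp add: field_simps power2_eq_square)
        then show ?thesis by (simp add: d_def e_def)
      qed
      finally have "0 \<le> s * (d + s * e)" by simp
      then show ?thesis using s by (simp add: zero_le_mult_iff)
    qed
    then have "eventually (\<lambda>s. 0 \<le> d + s * e) (at_right 0)"
      using eventually_at_right_real[of 0 "1::real"] by (auto elim: eventually_mono)
    moreover have "((\<lambda>s. d + s * e) \<longlongrightarrow> d + 0 * e) (at_right 0)"
      by (intro tendsto_intros)
    ultimately have "0 \<le> d"
      using tendsto_lowerbound[of "\<lambda>s. d + s * e" d "at_right 0" 0] by simp
    then have "(w - u) \<bullet> ((1 / t) *\<^sub>R (x - u)) \<le> a - b"
      by (simp add: d_def inner_commute)
    then show ?thesis unfolding inner_diff_left by linarith
  qed
  then show ?thesis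
    by (auto simp: subdifferential_iff_conjugate_le[of f u b, OF b] conjugate_le_iff)
qed

text \<open>Fermat's rule at one minimizer, tested at another, forces the two to coincide.\<close>

lemma prox_eqI:
  fixes f :: "'a::real_inner \<Rightarrow> ereal"
  assumes f: "f \<in> Gamma0" and t: "t > 0" and b: "f u = ereal b"
    and min: "\<And>w. prox_objective t f x u \<le> prox_objective t f x w"
  shows "prox t f x = u"
  unfolding prox_def
proof (rule the_equality)
  show "is_arg_min (prox_objective t f x) (\<lambda>_. True) u"
    using min by (auto simp: is_arg_min_def not_less)
  fix w assume "is_arg_min (prox_objective t f x) (\<lambda>_. True) w"
  then have w: "prox_objective t f x w \<le> prox_objective t f x u"
    by (auto simp: is_arg_min_def not_less)
  then obtain a where a: "f w = ereal a"
    using Gamma0_finite[OF f, of w] b by (cases "f w") (auto simp: prox_objective_def)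
  have "ereal b + ereal (((1 / t) *\<^sub>R (x - u)) \<bullet> (w - u)) \<le> ereal a"
    using prox_optimality[OF f t b min] unfolding subdifferential_def a[symmetric] b[symmetric] by blast
  then have "b + (x - u) \<bullet> (w - u) / t \<le> a" by simp
  moreover have "a + (norm (x - w))\<^sup>2 / (2 * t) \<le> b + (norm (x - u))\<^sup>2 / (2 * t)"
    using w by (simp add: prox_objective_def a b)
  moreover have "(norm (x - w))\<^sup>2
      = (norm (x - u))\<^sup>2 - 2 * ((x - u) \<bullet> (w - u)) + (norm (w - u))\<^sup>2"
    unfolding power2_norm_eq_inner
    by (simp add: inner_diff_left inner_diff_right inner_commute algebra_simps)
  ultimately have "(norm (w - u))\<^sup>2 / (2 * t) \<le> 0"
    by (simp add: add_divide_distrib diff_divide_distrib)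
  then have "(norm (w - u))\<^sup>2 \<le> 0"
    using t by (simp add: divide_le_0_iff)
  then show "w = u" by simp
qed

lemma moreau_envelope_eqI:
  assumes "\<And>w. prox_objective t f x u \<le> prox_objective t f x w"
  shows "moreau_envelope t f x = prox_objective t f x u"
  unfolding moreau_envelope_def by (rule Least_equality) (use assms in auto)

section \<open>The function jointly in the point and the parameter\<close>

lemma epi_p_fun:
  fixes f :: "'a::euclidean_space \<Rightarrow> ereal"
  assumes f: "f \<in> Gamma0"
  shows "epi (p_fun f) = epi_sum f"
proof -
  have "p_fun f (x, t) \<le> ereal \<alpha> \<longleftrightarrow> ((x, t), \<alpha>) \<in> epi_sum f" for x t \<alpha>
  proof (rule linorder_cases[of t 0])
    assume "t < 0"
    then show ?thesis by (simp add: p_fun_def mem_epi_sum_iff perspective_cone_def)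
  next
    assume "t = 0"
    moreover have "f x \<le> ereal \<alpha> \<longleftrightarrow> (\<exists>r\<ge>0. f x \<le> ereal (\<alpha> - r))"
      by (auto intro!: exI[of _ 0] elim: order_trans)
    ultimately show ?thesis
      by (auto simp: p_fun_def mem_epi_sum_iff perspective_cone_def epi_def)
  next
    assume t: "0 < t"
    obtain u where min: "\<And>w. prox_objective t f x u \<le> prox_objective t f x w"
      using prox_objective_attains_min[OF f t, of x] by blast
    then have "p_fun f (x, t) \<le> ereal \<alpha> \<longleftrightarrow> (\<exists>w. prox_objective t f x w \<le> ereal \<alpha>)"
      using t by (auto simp: p_fun_def moreau_envelope_eqI[OF min] intro: order_trans)
    with prox_objective_le_iff[OF t] show ?thesis by simp
  qed
  then show ?thesis by (auto simp: epi_def)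
qed

lemma p_fun_Gamma0:
  fixes f :: "'a::euclidean_space \<Rightarrow> ereal"
  assumes f: "f \<in> Gamma0"
  shows "p_fun f \<in> Gamma0"
proof -
  have "p_fun f (x, t) \<noteq> -\<infinity>" for x t
  proof (cases "t > 0")
    case True
    obtain u b where b: "f u = ereal b"
      and min: "\<And>w. prox_objective t f x u \<le> prox_objective t f x w"
      using prox_objective_attains_min[OF f True, of x] by blast
    then show ?thesis
      using True by (simp add: p_fun_def moreau_envelope_eqI[OF min] prox_objective_def)
  qed (simp add: p_fun_def Gamma0_finite[OF f])
  moreover obtain x a where "f x = ereal a"
    using Gamma0_epi_nonempty[OF f] by blast
  then have "(x, 0) \<in> edom (p_fun f)" by (simp add: edom_def p_fun_def)
  ultimately have "proper (p_fun f)" by (auto simp: proper_def)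
  then show ?thesis
    using closed_epi_sum[OF f] convex_epi_sum[OF f] by (simp add: Gamma0_def epi_p_fun[OF f])
qed

text \<open>The support function of a Minkowski sum is the sum of the support functions of the summands, and
  that of a cone is the indicator of its polar.\<close>

lemma conjugate_p_fun_le_iff:
  fixes f :: "'a::euclidean_space \<Rightarrow> ereal"
  assumes f: "f \<in> Gamma0"
  shows "conjugate (p_fun f) (y, \<mu>) \<le> ereal c
    \<longleftrightarrow> conjugate f y \<le> ereal c \<and> 1/2 * (norm y)\<^sup>2 \<le> - \<mu>"
proof -
  have eq: "conjugate (p_fun f) (y, \<mu>) \<le> ereal c
      \<longleftrightarrow> (\<forall>x t \<alpha>. ((x, t), \<alpha>) \<in> epi_sum f \<longrightarrow> x \<bullet> y + t * \<mu> - \<alpha> \<le> c)"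
    by (auto simp: conjugate_le_iff epi_p_fun[OF f] inner_Pair)
  show ?thesis
  proof
    assume "conjugate (p_fun f) (y, \<mu>) \<le> ereal c"
    then have *: "x \<bullet> y + t * \<mu> - \<alpha> \<le> c" if "((x, t), \<alpha>) \<in> epi_sum f" for x t \<alpha>
      using eq that by blast
    \<comment> \<open>The vectors \<open>(s y, s, s |y|\<^sup>2 / 2)\<close> of the cone are those for which Young's inequality
      is an equality at \<open>y\<close>.\<close>
    have ray: "u \<bullet> y - a + s * (1/2 * (norm y)\<^sup>2 + \<mu>) \<le> c" if "(u, a) \<in> epi f" "0 \<le> s" for u a s
    proof -
      have "(s *\<^sub>R y, s, s * (1/2 * (norm y)\<^sup>2)) \<in> perspective_cone"
        using that by (simp add: perspective_cone_def power_mult_distrib power2_eq_square)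
      then have "((u + s *\<^sub>R y, s), a + s * (1/2 * (norm y)\<^sup>2)) \<in> epi_sum f"
        using that unfolding mem_epi_sum_iff
        by (intro exI[of _ u] exI[of _ "s * (1/2 * (norm y)\<^sup>2)"]) simp
      from *[OF this] show ?thesis
        by (simp add: inner_add_left power2_norm_eq_inner algebra_simps)
    qed
    have "conjugate f y \<le> ereal c"
      using ray[of _ _ 0] by (auto simp: conjugate_le_iff)
    moreover have "1/2 * (norm y)\<^sup>2 + \<mu> \<le> 0"
    proof (rule ccontr)
      assume pos: "\<not> ?thesis"
      obtain u a where ua: "(u, a) \<in> epi f"
        using Gamma0_epi_nonempty[OF f] by blast
      define s where "s = (\<bar>c - (u \<bullet> y - a)\<bar> + 1) / (1/2 * (norm y)\<^sup>2 + \<mu>)"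
      have "0 \<le> s" unfolding s_def using pos by (intro divide_nonneg_nonneg) auto
      moreover have "s * (1/2 * (norm y)\<^sup>2 + \<mu>) = \<bar>c - (u \<bullet> y - a)\<bar> + 1"
        unfolding s_def using pos by simp
      ultimately show False using ray[OF ua, of s] by linarith
    qed
    ultimately show "conjugate f y \<le> ereal c \<and> 1/2 * (norm y)\<^sup>2 \<le> - \<mu>" by simp
  next
    assume "conjugate f y \<le> ereal c \<and> 1/2 * (norm y)\<^sup>2 \<le> - \<mu>"
    then show "conjugate (p_fun f) (y, \<mu>) \<le> ereal c"
      unfolding eq by (blast intro: epi_sum_bound)
  qed
qed

lemma conjugate_p_fun:
  fixes f :: "'a::euclidean_space \<Rightarrow> ereal"
  assumes f: "f \<in> Gamma0"
  shows "conjugate (p_fun f) (y, \<mu>)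
    = conjugate f y + ind (epi (\<lambda>z::'a. ereal (1/2 * (norm z)\<^sup>2))) (y, - \<mu>)"
proof (rule ereal_eqI_le_real)
  fix c :: real
  show "conjugate (p_fun f) (y, \<mu>) \<le> ereal c \<longleftrightarrow>
      conjugate f y + ind (epi (\<lambda>z::'a. ereal (1/2 * (norm z)\<^sup>2))) (y, - \<mu>) \<le> ereal c"
    using conjugate_not_MInf[OF f, of y]
    unfolding conjugate_p_fun_le_iff[OF f] by (auto simp: ind_def epi_def)
qed

lemma subdifferential_p_fun_iff:
  fixes f :: "'a::euclidean_space \<Rightarrow> ereal"
  assumes "f \<in> Gamma0" "p_fun f (x, t) = ereal b"
  shows "(v, \<mu>) \<in> subdifferential (p_fun f) (x, t)
    \<longleftrightarrow> conjugate f v \<le> ereal (x \<bullet> v + t * \<mu> - b) \<and> 1/2 * (norm v)\<^sup>2 \<le> - \<mu>"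
  using assms
  by (simp add: subdifferential_iff_conjugate_le conjugate_p_fun_le_iff inner_Pair)

lemma subdifferential_p_fun_0:
  fixes f :: "'a::euclidean_space \<Rightarrow> ereal"
  assumes f: "f \<in> Gamma0" and dom: "(x, 0) \<in> edom (p_fun f)"
  shows "subdifferential (p_fun f) (x, 0)
    = {(v, - \<beta>) | v \<beta>. v \<in> subdifferential f x \<and> 1/2 * (norm v)\<^sup>2 \<le> \<beta>}"
proof -
  have x: "p_fun f (x, 0) = f x" by (simp add: p_fun_def)
  then obtain b where b: "f x = ereal b"
    using dom Gamma0_finite[OF f, of x] by (cases "f x") (auto simp: edom_def)
  have "(v, \<mu>) \<in> subdifferential (p_fun f) (x, 0)
      \<longleftrightarrow> (v, \<mu>) \<in> {(v, - \<beta>) | v \<beta>. v \<in> subdifferential f x \<and> 1/2 * (norm v)\<^sup>2 \<le> \<beta>}" for v \<mu>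
  proof -
    have "(v, \<mu>) \<in> subdifferential (p_fun f) (x, 0)
        \<longleftrightarrow> v \<in> subdifferential f x \<and> 1/2 * (norm v)\<^sup>2 \<le> - \<mu>"
      using subdifferential_p_fun_iff[OF f, of x 0 b v \<mu>] subdifferential_iff_conjugate_le[of f x b v, OF b]
      by (simp add: x b)
    also have "\<dots> \<longleftrightarrow> (v, \<mu>) \<in> {(v, - \<beta>) | v \<beta>. v \<in> subdifferential f x \<and> 1/2 * (norm v)\<^sup>2 \<le> \<beta>}"
      by (auto intro!: exI[of _ "- \<mu>"])
    finally show ?thesis .
  qed
  then show ?thesis by (intro set_eqI) (simp only: split_paired_all)
qed

text \<open>With \<open>u\<close> the proximal point, a subgradient must attain equality both in the Fenchel-Young
  inequality of \<open>f\<close> at \<open>u\<close> and in Young's inequality at the cone vector over \<open>(x - u, t)\<close>.\<close>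

lemma subdifferential_p_fun_pos:
  fixes f :: "'a::euclidean_space \<Rightarrow> ereal"
  assumes f: "f \<in> Gamma0" and t: "t > 0"
  shows "subdifferential (p_fun f) (x, t)
    = {((1 / t) *\<^sub>R (x - prox t f x), - (1/2 * (norm ((1 / t) *\<^sub>R (x - prox t f x)))\<^sup>2))}"
proof -
  obtain u b where b: "f u = ereal b"
    and min: "\<And>w. prox_objective t f x u \<le> prox_objective t f x w"
    using prox_objective_attains_min[OF f t, of x] by blast
  define d where "d = (1 / t) *\<^sub>R (x - u)"
  have xu: "x = u + t *\<^sub>R d" using t by (simp add: d_def)
  have u: "prox t f x = u" by (rule prox_eqI[OF f t b min])
  have "prox_objective t f x u = ereal (b + t * (1/2 * (norm d)\<^sup>2))"
    using t by (simp add: prox_objective_def b xu power_mult_distrib power2_eq_square)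
  then have p: "p_fun f (x, t) = ereal (b + t * (1/2 * (norm d)\<^sup>2))"
    using t by (simp add: p_fun_def moreau_envelope_eqI[OF min])
  have opt: "conjugate f d \<le> ereal (u \<bullet> d - b)"
    using prox_optimality[OF f t b min] subdifferential_iff_conjugate_le[of f u b d, OF b]
    by (simp add: d_def)
  have "(v, \<mu>) \<in> subdifferential (p_fun f) (x, t) \<longleftrightarrow> v = d \<and> \<mu> = - (1/2 * (norm d)\<^sup>2)" for v \<mu>
    unfolding subdifferential_p_fun_iff[OF f p]
  proof
    assume a: "conjugate f v \<le> ereal (x \<bullet> v + t * \<mu> - (b + t * (1/2 * (norm d)\<^sup>2)))
      \<and> 1/2 * (norm v)\<^sup>2 \<le> - \<mu>"
    have "(u, b) \<in> epi f" using b by (simp add: epi_def)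
    then have "u \<bullet> v - b \<le> x \<bullet> v + t * \<mu> - (b + t * (1/2 * (norm d)\<^sup>2))"
      using a by (auto simp: conjugate_le_iff)
    then have "0 \<le> t * (d \<bullet> v + \<mu> - 1/2 * (norm d)\<^sup>2)"
      by (simp add: xu inner_add_left algebra_simps)
    then have le: "0 \<le> d \<bullet> v + \<mu> - 1/2 * (norm d)\<^sup>2"
      using t by (simp add: zero_le_mult_iff)
    have sq: "(norm (v - d))\<^sup>2 = (norm v)\<^sup>2 - 2 * (d \<bullet> v) + (norm d)\<^sup>2"
      by (simp add: power2_norm_eq_inner inner_diff_left inner_diff_right inner_commute)
    then have "(norm (v - d))\<^sup>2 \<le> 0" using le a by simp
    then have "v = d" by simp
    with le a show "v = d \<and> \<mu> = - (1/2 * (norm d)\<^sup>2)"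
      by (simp add: power2_norm_eq_inner)
  next
    assume "v = d \<and> \<mu> = - (1/2 * (norm d)\<^sup>2)"
    with opt show "conjugate f v \<le> ereal (x \<bullet> v + t * \<mu> - (b + t * (1/2 * (norm d)\<^sup>2)))
      \<and> 1/2 * (norm v)\<^sup>2 \<le> - \<mu>"
      by (simp add: xu inner_add_left power2_norm_eq_inner)
  qed
  then show ?thesis by (force simp: u d_def)
qed

theorem corollary6:
  fixes f :: "'a::euclidean_space \<Rightarrow> ereal"
  assumes "f \<in> Gamma0"
  shows "p_fun f \<in> Gamma0
    \<and> (\<forall>y \<mu>. conjugate (p_fun f) (y, \<mu>)
          = conjugate f y + ind (epi (\<lambda>z::'a. ereal (1/2 * (norm z)\<^sup>2))) (y, - \<mu>))
    \<and> conjugate (p_fun f) \<in> Gamma0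
    \<and> (\<forall>(x, t) \<in> edom (p_fun f).
          (t > 0 \<longrightarrow> subdifferential (p_fun f) (x, t)
             = {((1 / t) *\<^sub>R (x - prox t f x), - (1/2 * (norm ((1 / t) *\<^sub>R (x - prox t f x)))\<^sup>2))})
        \<and> (t = 0 \<longrightarrow> subdifferential (p_fun f) (x, t)
             = {(v, - \<beta>) | v \<beta>. v \<in> subdifferential f x \<and> 1/2 * (norm v)\<^sup>2 \<le> \<beta>}))"
  using p_fun_Gamma0[OF assms] conjugate_p_fun[OF assms] conjugate_Gamma0[OF p_fun_Gamma0[OF assms]]
    subdifferential_p_fun_pos[OF assms] subdifferential_p_fun_0[OF assms]
  by auto

end
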